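(* Let $X=\{-1,1\}^{\mathbb N}$, let $A:X\to\mathbb R$ be a continuous potential in the class $\mathcal F$, and let $\lambda_A$ be the spectral radius of $\mathscr L_A$ acting on $C(X)$. Suppose that for some $x\in X$ we have $0<\inf\{\lambda_A^{-n}\mathscr L_A^n(1)(x):n\ge1\}$, and that for every finite $B\subset\mathbb N$ $$\lim_{n\to\infty}\left|\frac1n\sum_{j=0}^{n-1}\lambda_A^{-j}\mathscr L_A^j(\varphi_B)(1^\infty)-\frac1n\sum_{j=0}^{n-1}\lambda_A^{-j}\mathscr L_A^j(\varphi_B)(-1^\infty)\right|=0 .$$ Then there exists a continuous positive eigenfunction $h$ of $\mathscr L_A$ associated to $\lambda_A$. Moreover, the measures $\mu^{+}$ and $\mu^{-}$ coincide, and $\mathcal G^*(A)$ is a singleton.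
   Context: Here $\mathbb N=\{1,2,\dots\}$ indexes coordinates, $x=(x_1,x_2,\dots)$, and $ix=(i,x_1,x_2,\dots)$ for $i=\pm1$; $1^\infty=(1,1,\dots)$, $-1^\infty=(-1,-1,\dots)$. The Ruelle operator is $\mathscr L_A(f)(x)=\sum_{i=\pm1}e^{A(ix)}f(ix)$. $\mathcal G^*(A)$ is the set of Borel probability measures $\nu$ with $\mathscr L_A^*\nu=\lambda_A\nu$. Partial order: $y\succeq x$ iff $y_j\ge x_j$ for all $j$. Class $\mathcal F$: $A\in\mathcal F$ if for all $y\succeq x$ both $e^{A(-1x)}+e^{A(1x)}\le e^{A(-1y)}+e^{A(1y)}$ and $e^{A(1y)}-e^{A(1x)}\ge0$. For finite $B\subset\mathbb N$, $\varphi_B(x)=\prod_{i\in B}\frac12(1+x_i)$, with $\varphi_\emptyset\equiv1$. The measures $\mu^\pm$: along a subsequence $(n_k)$ such that the following limits exist for every cylinder set $C\subset X$, $\mu^{\pm}$ are the finite Borel measures on $X$ with $\mu^{\pm}(C)=\lim_{k\to\infty}\frac1{n_k}\sum_{j=0}^{n_k-1}\lambda_A^{-j}\mathscr L_A^j(1_C)(\pm1^\infty)$. *)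

theory Defs
  imports "HOL-Probability.Probability"
begin

text \<open>
  The space \<open>{-1,1}\<^sup>\<nat>\<close> is represented by \<open>nat \<Rightarrow> bool\<close>: \<open>True\<close> stands for the spin \<open>+1\<close> and
  \<open>False\<close> for \<open>-1\<close>, and the coordinate \<open>x\<^sub>j\<close>, \<open>j \<ge> 1\<close>, is \<open>x (j - 1)\<close>. The library topology on this
  type is the product of the discrete topologies, and the library order \<open>\<le>\<close> on it is the
  coordinatewise one, with \<open>-1 < 1\<close>.
\<close>

type_synonym config = "nat \<Rightarrow> bool"

definition spin :: "bool \<Rightarrow> real"
  where "spin b = (if b then 1 else -1)"

definition prepend :: "bool \<Rightarrow> config \<Rightarrow> config"
  where "prepend i x = case_nat i x"

abbreviation all_plus :: config
  where "all_plus \<equiv> \<lambda>_. True"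

abbreviation all_minus :: config
  where "all_minus \<equiv> \<lambda>_. False"

text \<open>
  The operator is needed on real functions and, for its spectrum, on complex ones.
\<close>

definition ruelle :: "(config \<Rightarrow> real) \<Rightarrow> (config \<Rightarrow> 'b::real_vector) \<Rightarrow> config \<Rightarrow> 'b"
  where "ruelle A f x = (\<Sum>i\<in>UNIV. exp (A (prepend i x)) *\<^sub>R f (prepend i x))"

text \<open>
  The spectrum of an operator \<open>T\<close> acting on the complex Banach space of bounded continuous functions
  with the supremum norm, which for a compact space is the space of all continuous functions.
  The operator \<open>R\<close> below is a bounded two-sided inverse of \<open>z I - T\<close>.
\<close>

definition spectrum :: "(('a::topological_space \<Rightarrow> complex) \<Rightarrow> ('a \<Rightarrow> complex)) \<Rightarrow> complex set"
  where "spectrum T =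
    {z. \<not> (\<exists>R :: ('a \<Rightarrow>\<^sub>C complex) \<Rightarrow>\<^sub>L ('a \<Rightarrow>\<^sub>C complex).
          \<forall>f g. blinfun_apply R g = f \<longleftrightarrow>
            (\<forall>x. z * apply_bcontfun f x - T (apply_bcontfun f) x = apply_bcontfun g x))}"

definition spectral_radius :: "(('a::topological_space \<Rightarrow> complex) \<Rightarrow> ('a \<Rightarrow> complex)) \<Rightarrow> real"
  where "spectral_radius T = (SUP z\<in>spectrum T. cmod z)"

definition lam :: "(config \<Rightarrow> real) \<Rightarrow> real"
  where "lam A = spectral_radius (ruelle A)"

definition class_F :: "(config \<Rightarrow> real) set"
  where "class_F = {A. \<forall>x y. x \<le> y \<longrightarrow>
    exp (A (prepend False x)) + exp (A (prepend True x))
      \<le> exp (A (prepend False y)) + exp (A (prepend True y)) \<and>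
    0 \<le> exp (A (prepend True y)) - exp (A (prepend True x))}"

definition phi :: "nat set \<Rightarrow> config \<Rightarrow> real"
  where "phi B x = (\<Prod>i\<in>B. (1 + spin (x i)) / 2)"

definition cesaro :: "(config \<Rightarrow> real) \<Rightarrow> (config \<Rightarrow> real) \<Rightarrow> config \<Rightarrow> nat \<Rightarrow> real"
  where "cesaro A f x n = (1 / real n) * (\<Sum>j<n. (ruelle A ^^ j) f x / lam A ^ j)"

definition cylinders :: "config set set"
  where "cylinders = {C. \<exists>B w. finite B \<and> C = {x. \<forall>i\<in>B. x i = w i}}"

text \<open>
  \<open>cesaro_measure A r z \<mu>\<close>: the finite Borel measure \<open>\<mu>\<close> is the one obtained at the point \<open>z\<close> along the
  subsequence \<open>r\<close>; the measures \<open>\<mu>\<^sup>+\<close> and \<open>\<mu>\<^sup>-\<close> are those at \<open>all_plus\<close> and \<open>all_minus\<close>.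
\<close>

definition cesaro_measure ::
    "(config \<Rightarrow> real) \<Rightarrow> (nat \<Rightarrow> nat) \<Rightarrow> config \<Rightarrow> config measure \<Rightarrow> bool"
  where "cesaro_measure A r z \<mu> \<longleftrightarrow>
    sets \<mu> = sets borel \<and> finite_measure \<mu> \<and>
    (\<forall>C\<in>cylinders. (\<lambda>k. cesaro A (indicator C) z (r k)) \<longlonglongrightarrow> measure \<mu> C)"

text \<open>
  The equation \<open>\<L>\<^sub>A\<^sup>* \<nu> = \<lambda>\<^sub>A \<nu>\<close> is an identity of functionals on the continuous functions.
\<close>

definition dual_eigenmeasures :: "(config \<Rightarrow> real) \<Rightarrow> config measure set"
  where "dual_eigenmeasures A = {\<nu>. sets \<nu> = sets borel \<and> prob_space \<nu> \<and>
    (\<forall>f :: config \<Rightarrow> real. continuous_on UNIV f \<longrightarrow>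
       integral\<^sup>L \<nu> (ruelle A f) = lam A * integral\<^sup>L \<nu> f)}"

end

theory Submission
  imports Defs
begin

text \<open>
  Class \<open>\<F>\<close> says that \<open>\<L>\<^sub>A\<close> preserves nonnegative increasing functions, so the Cesaro averages of
  an increasing function lie between their values at \<open>-1\<^sup>\<infinity>\<close> and \<open>1\<^sup>\<infinity>\<close>. For the constant \<open>1\<close> these
  values lie on either side of \<open>1\<close>, because \<open>\<L>\<^sub>A\<^sup>n(1)(-1\<^sup>\<infinity>) \<le> \<lambda>\<^sub>A\<^sup>n \<le> \<L>\<^sub>A\<^sup>n(1)(1\<^sup>\<infinity>)\<close>. As their difference tends
  to \<open>0\<close>, the averages of \<open>1\<close> tend to \<open>1\<close>, which forces \<open>\<L>\<^sub>A(1) = \<lambda>\<^sub>A\<close>: the eigenfunction is constant.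

  Now \<open>\<L>\<^sub>A / \<lambda>\<^sub>A\<close> is the transition operator of a Markov chain on \<open>X\<close> that prepends a random spin and is
  monotone. Coupling from the past yields a stationary law, that is, an eigenmeasure. For every
  eigenmeasure \<open>\<nu>\<close> the averages of \<open>\<phi>\<^sub>B\<close> have integral \<open>\<nu>(\<phi>\<^sub>B)\<close>, so their values at \<open>-1\<^sup>\<infinity>\<close> and \<open>1\<^sup>\<infinity>\<close>
  enclose \<open>\<nu>(\<phi>\<^sub>B)\<close> and both converge to it. This determines \<open>\<nu>\<close> and identifies it with \<open>\<mu>\<^sup>+\<close> and \<open>\<mu>\<^sup>-\<close>.
\<close>

subsection \<open>Configurations\<close>

text \<open>This is what makes the Borel sets of \<open>config\<close> agree with the product
  sigma-algebra. All subsets of the discrete space \<open>bool\<close> are open, and they are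
  finitely many, so they can serve as generators.\<close>

instance bool :: second_countable_topology
proof
  show "\<exists>B::bool set set. countable B \<and> open = generate_topology B"
    by (rule exI[of _ UNIV])
      (auto simp: fun_eq_iff Topological_Spaces.open_discrete intro: generate_topology.Basis)
qed

lemma prepend_0 [simp]: "prepend i x 0 = i"
  by (simp add: prepend_def)

lemma prepend_Suc [simp]: "prepend i x (Suc k) = x k"
  by (simp add: prepend_def)

lemma prepend_mono: "i \<le> j \<Longrightarrow> x \<le> y \<Longrightarrow> prepend i x \<le> prepend j y"
  by (auto simp: le_fun_def prepend_def split: nat.split)

lemma continuous_on_prepend [continuous_intros]:
  "continuous_on S f \<Longrightarrow> continuous_on S (\<lambda>x. prepend i (f x))"
proof (rule continuous_on_coordinatewise_then_product)
  fix k assume "continuous_on S f"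
  then show "continuous_on S (\<lambda>x. prepend i (f x) k)"
    by (cases k) (auto intro: continuous_on_compose2[OF continuous_on_product_coordinates])
qed

lemma compact_UNIV_config: "compact (UNIV :: config set)"
proof -
  have "compact (UNIV :: bool set)"
    by (simp add: finite_imp_compact)
  then have "compact_space (product_topology (\<lambda>_. euclidean :: bool topology) (UNIV :: nat set))"
    unfolding compact_space_product_topology by (simp add: compact_space_def)
  then show ?thesis
    by (simp add: euclidean_product_topology compact_space_def)
qed

lemma continuous_config_bounded:
  fixes f :: "config \<Rightarrow> 'b::real_normed_vector"
  assumes "continuous_on UNIV f"
  obtains c where "c \<ge> 0" "\<And>x. norm (f x) \<le> c"
proof -
  have "bounded (range f)"
    using compact_continuous_image[OF assms compact_UNIV_config] by (rule compact_imp_bounded)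
  then show ?thesis
    by (metis bounded_pos less_imp_le rangeI that)
qed

subsection \<open>The Ruelle operator\<close>

lemma ruelle_eq:
  "ruelle A f x = exp (A (prepend False x)) *\<^sub>R f (prepend False x)
    + exp (A (prepend True x)) *\<^sub>R f (prepend True x)"
  by (simp add: ruelle_def UNIV_bool)

lemma ruelle_add: "ruelle A (\<lambda>x. f x + g x) = (\<lambda>x. ruelle A f x + ruelle A g x)"
  by (simp add: ruelle_eq fun_eq_iff scaleR_add_right)

lemma ruelle_scaleR: "ruelle A (\<lambda>x. c *\<^sub>R f x) = (\<lambda>x. c *\<^sub>R ruelle A f x)"
  by (simp add: ruelle_eq fun_eq_iff scaleR_add_right mult.commute)

lemma ruelle_mult: "ruelle A (\<lambda>x. c * f x) = (\<lambda>x. c * ruelle A f x)"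
  for c :: "'b::real_algebra"
  by (simp add: ruelle_eq fun_eq_iff distrib_left)

lemma ruelle_of_real:
  "ruelle A (\<lambda>x. complex_of_real (f x)) = (\<lambda>x. of_real (ruelle A f x))"
  by (simp add: ruelle_eq fun_eq_iff scaleR_conv_of_real)

lemma ruelle_le: "(\<And>x. f x \<le> g x) \<Longrightarrow> ruelle A f x \<le> ruelle A g x"
  for f g :: "config \<Rightarrow> real"
  by (auto simp: ruelle_eq intro!: add_mono mult_left_mono)

lemma norm_ruelle_le: "norm (ruelle A f x) \<le> ruelle A (\<lambda>x. norm (f x)) x"
  unfolding ruelle_eq by (rule order_trans[OF norm_triangle_ineq]) simp

lemma ruelle_pow_add:
  "(ruelle A ^^ n) (\<lambda>x. f x + g x) = (\<lambda>x. (ruelle A ^^ n) f x + (ruelle A ^^ n) g x)"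
  by (induction n) (simp_all add: ruelle_add)

lemma ruelle_pow_scaleR:
  "(ruelle A ^^ n) (\<lambda>x. c *\<^sub>R f x) = (\<lambda>x. c *\<^sub>R (ruelle A ^^ n) f x)"
  by (induction n) (simp_all add: ruelle_scaleR)

lemma ruelle_pow_of_real:
  "(ruelle A ^^ n) (\<lambda>x. complex_of_real (f x)) = (\<lambda>x. of_real ((ruelle A ^^ n) f x))"
  by (induction n) (simp_all add: ruelle_of_real)

lemma ruelle_pow_le: "(\<And>x. f x \<le> g x) \<Longrightarrow> (ruelle A ^^ n) f x \<le> (ruelle A ^^ n) g x"
  for f g :: "config \<Rightarrow> real"
  by (induction n arbitrary: x) (simp_all add: ruelle_le)

text \<open>Positive weights allow \<open>norm\<close> to be moved inside \<open>ruelle\<close>.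
  Hence the iterates of the constant 1 control those of every bounded function, complex ones
  included.\<close>

lemma norm_ruelle_pow_le:
  assumes "\<And>x. norm (f x) \<le> c"
  shows "norm ((ruelle A ^^ n) f x) \<le> c * (ruelle A ^^ n) (\<lambda>_. 1) x"
proof (induction n arbitrary: x)
  case (Suc n)
  have "norm ((ruelle A ^^ Suc n) f x) \<le> ruelle A (\<lambda>x. norm ((ruelle A ^^ n) f x)) x"
    by (simp add: norm_ruelle_le)
  also have "\<dots> \<le> ruelle A (\<lambda>x. c * (ruelle A ^^ n) (\<lambda>_. 1) x) x"
    by (intro ruelle_le Suc.IH)
  finally show ?case
    by (simp add: ruelle_mult)
qed (use assms in simp)

lemma ruelle_pow_one_pos: "0 < (ruelle A ^^ n) (\<lambda>_. 1 :: real) x"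
  by (induction n arbitrary: x) (simp_all add: ruelle_eq add_pos_pos)

section \<open>Monotonicity and growth of the iterates for potentials in class F\<close>

locale attractive_potential =
  fixes A :: "config \<Rightarrow> real"
  assumes cont: "continuous_on UNIV A"
    and attractive: "A \<in> class_F"
begin

abbreviation upper :: "nat \<Rightarrow> real"
  where "upper n \<equiv> (ruelle A ^^ n) (\<lambda>_. 1) all_plus"

abbreviation lower :: "nat \<Rightarrow> real"
  where "lower n \<equiv> (ruelle A ^^ n) (\<lambda>_. 1) all_minus"

lemma continuous_ruelle:
  fixes f :: "config \<Rightarrow> 'b::real_normed_vector"
  assumes "continuous_on UNIV f"
  shows "continuous_on UNIV (ruelle A f)"
proof -
  have "continuous_on UNIV (prepend i)" for i
    by (rule continuous_on_prepend[OF continuous_on_id])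
  then have "continuous_on UNIV (\<lambda>x. exp (A (prepend i x)) *\<^sub>R f (prepend i x))" for i
    by (intro continuous_on_scaleR continuous_on_exp continuous_on_compose2[OF cont]
        continuous_on_compose2[OF assms]) auto
  then show ?thesis
    unfolding ruelle_def by (intro continuous_on_sum)
qed

lemma continuous_ruelle_pow:
  fixes f :: "config \<Rightarrow> 'b::real_normed_vector"
  shows "continuous_on UNIV f \<Longrightarrow> continuous_on UNIV ((ruelle A ^^ n) f)"
  by (induction n) (simp_all add: continuous_ruelle)

lemma exp_plus_mono: "x \<le> y \<Longrightarrow> exp (A (prepend True x)) \<le> exp (A (prepend True y))"
  using attractive unfolding class_F_def by fastforce

text \<open>The passage from \<open>x\<close> to \<open>y\<close> is made in two moves: first only
  the weights change, then only the values of \<open>f\<close>.\<close>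

lemma mono_ruelle:
  fixes f :: "config \<Rightarrow> real"
  assumes "mono f" and nonneg: "\<And>x. 0 \<le> f x"
  shows "mono (ruelle A f)"
proof (rule monoI)
  fix x y :: config assume xy: "x \<le> y"
  define a b c d where "a = exp (A (prepend False x))" and "b = exp (A (prepend True x))"
    and "c = exp (A (prepend False y))" and "d = exp (A (prepend True y))"
  have "a + b \<le> c + d" and "b \<le> d"
    using attractive xy unfolding class_F_def a_def b_def c_def d_def by fastforce+
  have fxy: "f (prepend i x) \<le> f (prepend i y)" for i
    using xy by (intro monoD[OF \<open>mono f\<close>] prepend_mono) auto
  have "f (prepend False x) \<le> f (prepend True x)"
    by (intro monoD[OF \<open>mono f\<close>] prepend_mono) auto
  \<comment> \<open>With the values of \<open>f\<close> frozen, the gain from the new weights is the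
    growth of the plus weight times the jump of \<open>f\<close>, plus the growth of the total
    weight times the smaller value of \<open>f\<close>. Each inequality of \<open>class_F\<close>
    makes one summand nonnegative.\<close>
  then have "(d - b) * (f (prepend True x) - f (prepend False x))
      + (c + d - a - b) * f (prepend False x) \<ge> 0"
    using \<open>a + b \<le> c + d\<close> \<open>b \<le> d\<close> nonneg by (intro add_nonneg_nonneg mult_nonneg_nonneg) auto
  then have "a * f (prepend False x) + b * f (prepend True x)
      \<le> c * f (prepend False x) + d * f (prepend True x)"
    by (simp add: algebra_simps)
  also have "\<dots> \<le> c * f (prepend False y) + d * f (prepend True y)"
    using fxy by (intro add_mono mult_left_mono) (auto simp: c_def d_def)
  finally show "ruelle A f x \<le> ruelle A f y"
    by (simp add: ruelle_eq a_def b_def c_def d_def)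
qed

lemma mono_ruelle_pow:
  fixes f :: "config \<Rightarrow> real"
  assumes "mono f" and nonneg: "\<And>x. 0 \<le> f x"
  shows "mono ((ruelle A ^^ n) f)"
proof (induction n)
  case (Suc n)
  \<comment> \<open>Comparison with the zero function, whose iterates vanish by
    \<open>ruelle_pow_scaleR\<close> with scalar 0.\<close>
  have "0 \<le> (ruelle A ^^ n) f x" for x
    using ruelle_pow_le[of "\<lambda>_. 0" f n A x] nonneg
      ruelle_pow_scaleR[of n A 0 "\<lambda>_. 0 :: real"] by (simp add: fun_eq_iff)
  with Suc show ?case
    by (simp add: mono_ruelle)
qed (use assms in simp)

lemma ruelle_pow_between:
  fixes f :: "config \<Rightarrow> real"
  assumes "mono f" and "\<And>x. 0 \<le> f x"
  shows "(ruelle A ^^ n) f all_minus \<le> (ruelle A ^^ n) f x"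
    and "(ruelle A ^^ n) f x \<le> (ruelle A ^^ n) f all_plus"
  by (auto intro!: monoD[OF mono_ruelle_pow] assms simp: le_fun_def)

lemma lower_le: "lower n \<le> (ruelle A ^^ n) (\<lambda>_. 1) x"
  and le_upper: "(ruelle A ^^ n) (\<lambda>_. 1) x \<le> upper n"
  by (auto intro!: ruelle_pow_between monoI)

text \<open>By monotonicity \<open>upper n\<close> is the maximum of the \<open>n\<close>-th iterate
  of 1, so it can be pulled out of the outer \<open>m\<close> applications. The minimum
  \<open>lower n\<close> behaves dually.\<close>

lemma upper_submult: "upper (m + n) \<le> upper m * upper n"
proof -
  have "(ruelle A ^^ m) ((ruelle A ^^ n) (\<lambda>_. 1)) all_plus
      \<le> (ruelle A ^^ m) (\<lambda>x. upper n *\<^sub>R 1 :: real) all_plus"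
    by (intro ruelle_pow_le) (simp add: le_upper)
  then show ?thesis
    unfolding ruelle_pow_scaleR by (simp add: funpow_add mult.commute)
qed

lemma lower_supermult: "lower m * lower n \<le> lower (m + n)"
proof -
  have "(ruelle A ^^ m) (\<lambda>x. lower n *\<^sub>R 1 :: real) all_minus
      \<le> (ruelle A ^^ m) ((ruelle A ^^ n) (\<lambda>_. 1)) all_minus"
    by (intro ruelle_pow_le) (simp add: lower_le)
  then show ?thesis
    unfolding ruelle_pow_scaleR by (simp add: funpow_add mult.commute)
qed

lemma upper_power: "upper (k * n) \<le> upper n ^ k"
proof (induction k)
  case (Suc k)
  have "upper (Suc k * n) \<le> upper n * upper (k * n)"
    using upper_submult[of n "k * n"] by simp
  also have "\<dots> \<le> upper n * upper n ^ k"
    by (intro mult_left_mono Suc.IH less_imp_le ruelle_pow_one_pos)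
  finally show ?case by simp
qed simp

lemma lower_power: "lower n ^ k \<le> lower (k * n)"
proof (induction k)
  case (Suc k)
  have "lower n * lower n ^ k \<le> lower n * lower (k * n)"
    by (intro mult_left_mono Suc.IH less_imp_le ruelle_pow_one_pos)
  also have "\<dots> \<le> lower (Suc k * n)"
    using lower_supermult[of n "k * n"] by simp
  finally show ?case by simp
qed simp

text \<open>Both sides are compared with the iterate of order \<open>m * n\<close>. This relates
  minima and maxima at unrelated times.\<close>

lemma lower_power_le_upper_power: "lower n ^ m \<le> upper m ^ n"
  using lower_power[of n m] upper_power[of n m] lower_le[of "m * n" all_plus]
  by (simp add: mult.commute)

end

subsection \<open>The spectral radius\<close>

text \<open>The quotients \<open>a n / t ^ n\<close> are again submultiplicative and drop below 1 at
  \<open>N\<close>. Sums over consecutive blocks of length \<open>N\<close> are therefore dominated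
  by a geometric series.\<close>

lemma submultiplicative_summable:
  fixes a :: "nat \<Rightarrow> real"
  assumes nonneg: "\<And>n. 0 \<le> a n" and submult: "\<And>m n. a (m + n) \<le> a m * a n"
    and "0 < N" and "0 < t" and less: "a N < t ^ N"
  shows "summable (\<lambda>n. a n / t ^ n)"
proof (rule summableI_nonneg_bounded)
  define b where "b n = a n / t ^ n" for n
  have b_nonneg: "0 \<le> b n" for n
    using nonneg \<open>0 < t\<close> by (simp add: b_def)
  have b_submult: "b (m + n) \<le> b m * b n" for m n
    using submult[of m n] \<open>0 < t\<close> by (simp add: b_def power_add divide_right_mono)
  have "b N < 1"
    using less \<open>0 < t\<close> by (simp add: b_def)
  have b_block: "b (m * N + i) \<le> b N ^ m * b i" for m i
  proof (induction m)
    case (Suc m)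
    have "b (Suc m * N + i) \<le> b N * b (m * N + i)"
      using b_submult[of N "m * N + i"] by (simp add: add.assoc)
    also have "\<dots> \<le> b N * (b N ^ m * b i)"
      by (intro mult_left_mono Suc.IH b_nonneg)
    finally show ?case by (simp add: mult.assoc)
  qed simp
  have block: "(\<Sum>j=m * N..<m * N + N. b j) = (\<Sum>i<N. b (m * N + i))" for m
    by (rule sum.reindex_bij_witness[of _ "\<lambda>i. m * N + i" "\<lambda>j. j - m * N"]) auto
  fix n
  have "(\<Sum>j<n. b j) \<le> (\<Sum>j<n * N. b j)"
    using \<open>0 < N\<close> b_nonneg by (intro sum_mono2) auto
  also have "\<dots> = (\<Sum>m<n. \<Sum>j=m * N..<m * N + N. b j)"
    by (simp add: sum.nat_group)
  also have "\<dots> = (\<Sum>m<n. \<Sum>i<N. b (m * N + i))"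
    by (simp only: block)
  also have "\<dots> \<le> (\<Sum>m<n. \<Sum>i<N. b N ^ m * b i)"
    by (intro sum_mono b_block)
  also have "\<dots> = (\<Sum>m<n. b N ^ m) * (\<Sum>i<N. b i)"
    by (simp add: sum_product)
  also have "\<dots> \<le> (\<Sum>m. b N ^ m) * (\<Sum>i<N. b i)"
    using b_nonneg \<open>b N < 1\<close>
    by (intro mult_right_mono sum_nonneg sum_le_suminf summable_geometric) auto
  finally show "(\<Sum>j<n. a j / t ^ j) \<le> (\<Sum>m. b N ^ m) * (\<Sum>i<N. b i)"
    by (simp add: b_def)
qed (use assms in simp)

section \<open>The resolvent as a Neumann series\<close>

context attractive_potential
begin

text \<open>The expansion of the resolvent of \<open>ruelle A\<close> at \<open>z\<close>, taken
  pointwise on plain functions; it is wrapped into a bounded continuous function only where the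
  operator norm is needed.\<close>

definition neumann :: "complex \<Rightarrow> (config \<Rightarrow> complex) \<Rightarrow> config \<Rightarrow> complex"
  where "neumann z g x = (\<Sum>n. (ruelle A ^^ n) g x / z ^ Suc n)"

lemma norm_ruelle_pow_le_upper:
  assumes "\<And>x. norm (f x) \<le> c"
  shows "norm ((ruelle A ^^ n) f x) \<le> c * upper n"
proof -
  have "0 \<le> c"
    using assms[of x] norm_ge_zero[of "f x"] by linarith
  then have "c * (ruelle A ^^ n) (\<lambda>_. 1) x \<le> c * upper n"
    by (intro mult_left_mono le_upper)
  with norm_ruelle_pow_le[OF assms] show ?thesis
    by (rule order_trans)
qed

text \<open>The majorant does not depend on \<open>x\<close>, so the series converges uniformly;
  this later yields continuity of the sum.\<close>

lemma
  fixes g :: "config \<Rightarrow> complex"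
  assumes z: "z \<noteq> 0" and sum: "summable (\<lambda>n. upper n / cmod z ^ n)"
    and g: "\<And>x. norm (g x) \<le> c"
  shows neumann_term_le: "norm ((ruelle A ^^ n) g x / z ^ Suc n)
      \<le> c / cmod z * (upper n / cmod z ^ n)" (is ?le)
    and summable_neumann: "summable (\<lambda>n. (ruelle A ^^ n) g x / z ^ Suc n)" (is ?summable)
    and norm_neumann_le: "norm (neumann z g x) \<le> c / cmod z * (\<Sum>n. upper n / cmod z ^ n)" (is ?norm)
proof -
  show le: "norm ((ruelle A ^^ n) g x / z ^ Suc n) \<le> c / cmod z * (upper n / cmod z ^ n)" for n
    using norm_ruelle_pow_le_upper[where f=g and c=c and n=n and x=x, OF g]
    by (simp add: norm_divide norm_mult norm_power divide_right_mono)
  have sum': "summable (\<lambda>n. c / cmod z * (upper n / cmod z ^ n))"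
    by (intro summable_mult sum)
  then show summable: ?summable
    by (rule summable_comparison_test'[where N=0]) (rule le)
  have summable': "summable (\<lambda>n. norm ((ruelle A ^^ n) g x / z ^ Suc n))"
    by (rule summable_comparison_test'[where N=0, OF sum']) (use le in simp)
  have "norm (neumann z g x) \<le> (\<Sum>n. norm ((ruelle A ^^ n) g x / z ^ Suc n))"
    unfolding neumann_def by (rule summable_norm[OF summable'])
  also have "\<dots> \<le> (\<Sum>n. c / cmod z * (upper n / cmod z ^ n))"
    by (intro suminf_le le summable' sum')
  finally show ?norm
    by (simp only: suminf_mult[OF sum])
qed

lemma neumann_bcontfun:
  fixes g :: "config \<Rightarrow>\<^sub>C complex"
  assumes z: "z \<noteq> 0" and sum: "summable (\<lambda>n. upper n / cmod z ^ n)"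
  shows "neumann z (apply_bcontfun g) \<in> bcontfun"
proof (rule bcontfun_normI)
  have "uniform_limit UNIV (\<lambda>n x. \<Sum>i<n. (ruelle A ^^ i) g x / z ^ Suc i) (neumann z g) sequentially"
    unfolding neumann_def[abs_def]
    by (rule Weierstrass_m_test[OF neumann_term_le[OF z sum norm_bounded]])
      (intro summable_mult sum)
  then show "continuous_on UNIV (neumann z g)"
    by (rule uniform_limit_theorem[rotated])
      (auto intro!: always_eventually continuous_on_sum continuous_on_divide continuous_ruelle_pow
        simp: z)
qed (rule norm_neumann_le[OF z sum norm_bounded])

lemma neumann_solves:
  fixes g :: "config \<Rightarrow> complex"
  assumes z: "z \<noteq> 0" and sum: "summable (\<lambda>n. upper n / cmod z ^ n)"
    and g: "\<And>x. norm (g x) \<le> c"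
  shows "z * neumann z g x - ruelle A (neumann z g) x = g x"
proof -
  let ?t = "\<lambda>n x. (ruelle A ^^ n) g x / z ^ Suc n"
  have S: "summable (\<lambda>n. ?t n x)" for x
    by (rule summable_neumann[OF z sum]) (rule g)
  have "(\<lambda>n. exp (A (prepend False x)) *\<^sub>R ?t n (prepend False x)
        + exp (A (prepend True x)) *\<^sub>R ?t n (prepend True x)) sums ruelle A (neumann z g) x"
    unfolding ruelle_eq[of A "neumann z g"] neumann_def
    by (intro sums_add sums_scaleR_right summable_sums S)
  \<comment> \<open>Applying the operator shifts the series by one index at the price of a factor
    \<open>z\<close>, so only the term of index 0 survives in the difference.\<close>
  moreover have "(exp (A (prepend False x)) *\<^sub>R ?t n (prepend False x)
        + exp (A (prepend True x)) *\<^sub>R ?t n (prepend True x)) = z * ?t (Suc n) x" for n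
    using z by (simp add: ruelle_eq[of A "(ruelle A ^^ n) g"] field_simps scaleR_conv_of_real)
  ultimately have "(\<lambda>n. z * ?t (Suc n) x) sums ruelle A (neumann z g) x"
    by simp
  moreover have "(\<lambda>n. z * ?t (Suc n) x) sums (z * (neumann z g x - ?t 0 x))"
    using S[of x] unfolding neumann_def
    by (intro sums_mult) (subst sums_Suc_iff, simp add: summable_sums)
  ultimately have "ruelle A (neumann z g) x = z * (neumann z g x - ?t 0 x)"
    by (rule sums_unique2)
  then show ?thesis
    using z by (simp add: algebra_simps)
qed

text \<open>The difference \<open>h\<close> of two solutions satisfies
  \<open>ruelle A h = z * h\<close>. Iterating bounds \<open>norm (h x)\<close> by a constant times
  \<open>upper n / cmod z ^ n\<close>, a null sequence by summability.\<close>

lemma resolvent_unique: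
  fixes f g :: "config \<Rightarrow> complex"
  assumes z: "z \<noteq> 0" and sum: "summable (\<lambda>n. upper n / cmod z ^ n)"
    and f: "\<And>x. norm (f x) \<le> c" and g: "\<And>x. norm (g x) \<le> d"
    and eq: "\<And>x. z * f x - ruelle A f x = z * g x - ruelle A g x"
  shows "f x = g x"
proof -
  define h where "h = (\<lambda>x. f x + (-1) *\<^sub>R g x)"
  have "ruelle A h x = z * h x" for x
    using eq[of x] unfolding h_def ruelle_add ruelle_scaleR by (simp add: algebra_simps)
  then have h: "ruelle A h = (\<lambda>x. z * h x)"
    by auto
  have pow: "(ruelle A ^^ n) h = (\<lambda>x. z ^ n * h x)" for n
    by (induction n) (simp_all add: ruelle_mult h mult.assoc mult.left_commute)
  have h_le: "norm (h x) \<le> c + d" for x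
    using norm_triangle_ineq4[of "f x" "g x"] f[of x] g[of x] by (simp add: h_def)
  have "norm (h x) \<le> (c + d) * (upper n / cmod z ^ n)" for n
    using norm_ruelle_pow_le_upper[where f=h and n=n and x=x, OF h_le] z
    by (simp add: pow norm_mult norm_power field_simps)
  moreover have "(\<lambda>n. (c + d) * (upper n / cmod z ^ n)) \<longlonglongrightarrow> (c + d) * 0"
    by (intro tendsto_mult_left summable_LIMSEQ_zero sum)
  ultimately have "norm (h x) \<le> 0"
    by (intro LIMSEQ_le_const) auto
  then show ?thesis
    by (simp add: h_def)
qed

text \<open>The equivalence in \<open>spectrum\<close> asks for a solution and for its uniqueness;
  \<open>neumann_solves\<close> and \<open>resolvent_unique\<close> supply these. Uniqueness also
  gives linearity of the solution operator.\<close>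

lemma not_in_spectrum:
  assumes z: "z \<noteq> 0" and sum: "summable (\<lambda>n. upper n / cmod z ^ n)"
  shows "z \<notin> spectrum (ruelle A)"
proof -
  define S where "S g = Bcontfun (neumann z (apply_bcontfun g))" for g
  have S_apply: "apply_bcontfun (S g) = neumann z (apply_bcontfun g)" for g
    unfolding S_def by (rule Bcontfun_inverse) (rule neumann_bcontfun[OF z sum])
  have solves: "z * S g x - ruelle A (S g) x = g x" for g x
    unfolding S_apply by (rule neumann_solves[OF z sum norm_bounded])
  have unique: "S g = f" if "\<And>x. z * f x - ruelle A f x = g x"
    for f g :: "config \<Rightarrow>\<^sub>C complex"
    by (rule bcontfun_eqI, rule resolvent_unique[OF z sum norm_bounded norm_bounded])
      (simp add: solves that)
  have "bounded_linear S"
  proof (rule bounded_linear_intro)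
    show "S (f + g) = S f + S g" for f g
    proof (rule unique)
      fix x
      have "z * (S f + S g) x - ruelle A (S f + S g) x
          = (z * S f x - ruelle A (S f) x) + (z * S g x - ruelle A (S g) x)"
        by (simp add: plus_bcontfun.rep_eq ruelle_add algebra_simps)
      then show "z * (S f + S g) x - ruelle A (S f + S g) x = (f + g) x"
        by (simp only: solves plus_bcontfun.rep_eq)
    qed
    show "S (r *\<^sub>R f) = r *\<^sub>R S f" for r f
    proof (rule unique)
      fix x
      have "z * (r *\<^sub>R S f) x - ruelle A (r *\<^sub>R S f) x = r *\<^sub>R (z * S f x - ruelle A (S f) x)"
        by (simp add: scaleR_bcontfun.rep_eq ruelle_scaleR scaleR_right_diff_distrib)
      then show "z * (r *\<^sub>R S f) x - ruelle A (r *\<^sub>R S f) x = (r *\<^sub>R f) x"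
        by (simp only: solves scaleR_bcontfun.rep_eq)
    qed
    show "norm (S f) \<le> norm f * (1 / cmod z * (\<Sum>n. upper n / cmod z ^ n))" for f
      using norm_neumann_le[OF z sum norm_bounded[of f]] by (intro norm_bound) (simp add: S_apply)
  qed
  then have "blinfun_apply (Blinfun S) = S"
    by (rule bounded_linear_Blinfun_apply)
  with solves unique have "\<forall>f g. blinfun_apply (Blinfun S) g = f \<longleftrightarrow>
      (\<forall>x. z * apply_bcontfun f x - ruelle A (apply_bcontfun f) x = apply_bcontfun g x)"
    by metis
  then show ?thesis
    unfolding spectrum_def by blast
qed

text \<open>Since \<open>upper n\<close> is the operator norm of the \<open>n\<close>-th iterate,
  this is Gelfand's formula with an infimum. The index 0 is left out because \<open>root 0\<close>
  is 0 by convention.\<close>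

definition growth :: real
  where "growth = (INF n\<in>{1..}. root n (upper n))"

lemma root_lower_le_growth: "1 \<le> n \<Longrightarrow> root n (lower n) \<le> growth"
  unfolding growth_def
proof (rule cINF_greatest)
  fix m :: nat assume m: "m \<in> {1..}" and n: "1 \<le> n"
  \<comment> \<open>The exponent \<open>n * m\<close> clears both roots at once and leaves
    \<open>lower_power_le_upper_power\<close>.\<close>
  have "root n (lower n) ^ (n * m) \<le> root m (upper m) ^ (n * m)"
  proof -
    have "root n (lower n) ^ (n * m) = lower n ^ m"
      using n by (simp add: power_mult real_root_pow_pos2 ruelle_pow_one_pos less_imp_le)
    moreover have "root m (upper m) ^ (n * m) = upper m ^ n"
      using m unfolding mult.commute[of n m] power_mult
      by (simp add: real_root_pow_pos2 ruelle_pow_one_pos less_imp_le)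
    ultimately show ?thesis
      using lower_power_le_upper_power by simp
  qed
  then show "root n (lower n) \<le> root m (upper m)"
    using n m by (subst (asm) power_mono_iff) (auto intro!: real_root_ge_zero less_imp_le ruelle_pow_one_pos)
qed auto

lemma growth_pos: "0 < growth"
  using root_lower_le_growth[of 1] ruelle_pow_one_pos[of 1 A all_minus] by simp

lemma lower_le_growth_power: "lower n \<le> growth ^ n"
proof (cases "n = 0")
  case False
  then have "root n (lower n) ^ n \<le> growth ^ n"
    by (intro power_mono root_lower_le_growth)
      (auto intro: real_root_ge_zero less_imp_le ruelle_pow_one_pos)
  with False show ?thesis
    by (simp add: real_root_pow_pos2 ruelle_pow_one_pos less_imp_le)
qed simp

lemma bdd_below_roots: "bdd_below ((\<lambda>n. root n (upper n)) ` {1..})"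
  by (intro bdd_belowI2[where m=0] real_root_ge_zero less_imp_le ruelle_pow_one_pos)

lemma growth_power_le_upper: "growth ^ n \<le> upper n"
proof (cases "n = 0")
  case False
  then have "growth \<le> root n (upper n)"
    unfolding growth_def by (intro cINF_lower bdd_below_roots) auto
  then have "growth ^ n \<le> root n (upper n) ^ n"
    using growth_pos by (intro power_mono) auto
  with False show ?thesis
    by (simp add: real_root_pow_pos2 ruelle_pow_one_pos less_imp_le)
qed simp

lemma summable_upper:
  assumes "growth < t"
  shows "summable (\<lambda>n. upper n / t ^ n)"
proof -
  obtain N where N: "1 \<le> N" "root N (upper N) < t"
    using assms cINF_less_iff[OF _ bdd_below_roots] unfolding growth_def by fastforce
  have "upper N = root N (upper N) ^ N"
    using N by (simp add: real_root_pow_pos2 ruelle_pow_one_pos less_imp_le)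
  also have "\<dots> < t ^ N"
    using N by (intro power_strict_mono real_root_ge_zero less_imp_le ruelle_pow_one_pos) auto
  finally show ?thesis
    using N assms growth_pos
    by (intro submultiplicative_summable[where N=N] upper_submult less_imp_le ruelle_pow_one_pos) auto
qed

lemma spectrum_le_growth:
  assumes "z \<in> spectrum (ruelle A)"
  shows "cmod z \<le> growth"
proof (rule ccontr)
  assume "\<not> cmod z \<le> growth"
  then have "z \<noteq> 0" and "summable (\<lambda>n. upper n / cmod z ^ n)"
    using growth_pos by (auto intro: summable_upper)
  with not_in_spectrum assms show False
    by blast
qed

text \<open>All terms are positive and \<open>upper n\<close> is at least \<open>growth ^ n\<close>,
  so the series dominates a geometric one.\<close>

lemma neumann_one_ge:
  assumes "growth < t"
  shows "1 / (t - growth) \<le> norm (neumann (of_real t) (\<lambda>_. 1) all_plus)"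
proof -
  have "0 < t"
    using assms growth_pos by simp
  have "(\<lambda>n. (growth / t) ^ n) sums (1 / (1 - growth / t))"
    using assms growth_pos by (intro geometric_sums) auto
  then have "(\<lambda>n. 1 / t * (growth / t) ^ n) sums (1 / t * (1 / (1 - growth / t)))"
    by (rule sums_mult)
  moreover have "1 / t * (1 / (1 - growth / t)) = 1 / (t - growth)"
    using assms \<open>0 < t\<close> by (simp add: field_simps)
  ultimately have geom: "(\<lambda>n. 1 / t * (growth / t) ^ n) sums (1 / (t - growth))"
    by simp
  have sum: "summable (\<lambda>n. 1 / t * (upper n / t ^ n))"
    using assms by (intro summable_mult summable_upper)
  have "neumann (of_real t) (\<lambda>_. 1) all_plus = (\<Sum>n. of_real (1 / t * (upper n / t ^ n)))"
    using ruelle_pow_of_real[of _ A "\<lambda>_. 1"] by (simp add: neumann_def)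
  also have "\<dots> = of_real (\<Sum>n. 1 / t * (upper n / t ^ n))"
    by (rule suminf_of_real[OF sum, symmetric])
  also have "norm \<dots> \<ge> (\<Sum>n. 1 / t * (upper n / t ^ n))"
    by simp
  finally have "(\<Sum>n. 1 / t * (upper n / t ^ n)) \<le> norm (neumann (of_real t) (\<lambda>_. 1) all_plus)" .
  moreover have "1 / (t - growth) \<le> (\<Sum>n. 1 / t * (upper n / t ^ n))"
    using \<open>0 < t\<close> growth_power_le_upper
    by (intro sums_le[OF _ geom summable_sums[OF sum]])
      (simp add: power_divide divide_right_mono)
  ultimately show ?thesis
    by simp
qed

text \<open>
  If \<open>growth\<close> were in the resolvent set, the resolvent would be bounded on the real axis near it;
  but for \<open>t > growth\<close> the resolvent at \<open>t\<close> applied to \<open>1\<close> is at least \<open>1 / (t - growth)\<close> at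
  \<open>all_plus\<close>.
\<close>

lemma growth_in_spectrum: "of_real growth \<in> spectrum (ruelle A)"
proof (rule ccontr)
  assume "of_real growth \<notin> spectrum (ruelle A)"
  then obtain R :: "(config \<Rightarrow>\<^sub>C complex) \<Rightarrow>\<^sub>L (config \<Rightarrow>\<^sub>C complex)" where
    R: "blinfun_apply R g = f \<longleftrightarrow>
      (\<forall>x. of_real growth * apply_bcontfun f x - ruelle A (apply_bcontfun f) x = apply_bcontfun g x)" for f g
    unfolding spectrum_def by blast
  \<comment> \<open>Chosen so that \<open>norm R * e\<close> is below 1/2, which bounds the norm of
    the resolvent at \<open>t\<close> applied to 1 by \<open>2 * norm R\<close>, whereas
    \<open>1 / e\<close> exceeds that bound.\<close>
  define e where "e = 1 / (2 * norm R + 2)"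
  define t where "t = growth + e"
  have "0 < e"
    using norm_ge_zero[of R] by (simp add: e_def add_nonneg_pos)
  then have "growth < t" "0 < t"
    using growth_pos by (auto simp: t_def)
  define one :: "config \<Rightarrow>\<^sub>C complex" where "one = const_bcontfun 1"
  have one: "apply_bcontfun one = (\<lambda>_. 1)"
    by (simp add: one_def const_bcontfun.rep_eq)
  have t: "complex_of_real t \<noteq> 0" "summable (\<lambda>n. upper n / cmod (of_real t) ^ n)"
    using \<open>growth < t\<close> \<open>0 < t\<close> summable_upper by auto
  define f where "f = Bcontfun (neumann (of_real t) (apply_bcontfun one))"
  have f: "apply_bcontfun f = neumann (of_real t) (\<lambda>_. 1)"
    using Bcontfun_inverse[OF neumann_bcontfun[OF t, of one]] by (simp add: f_def one)
  \<comment> \<open>Lowering the spectral parameter from \<open>t\<close> to \<open>growth\<close>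
    turns the right-hand side 1 into \<open>one - e *\<^sub>R f\<close>.\<close>
  have "blinfun_apply R (one - e *\<^sub>R f) = f"
    unfolding R
  proof
    fix x
    have "of_real t * f x - ruelle A f x = 1"
      unfolding f by (rule neumann_solves[OF t, of _ 1]) simp
    then show "of_real growth * f x - ruelle A f x = (one - e *\<^sub>R f) x"
      by (simp add: t_def minus_bcontfun.rep_eq scaleR_bcontfun.rep_eq one scaleR_conv_of_real algebra_simps)
  qed
  then have "norm f \<le> norm R * norm (one - e *\<^sub>R f)"
    using norm_blinfun[of R "one - e *\<^sub>R f"] by simp
  also have "\<dots> \<le> norm R * (1 + e * norm f)"
  proof (rule mult_left_mono)
    have "norm one \<le> 1"
      by (intro norm_bound) (simp add: one)
    then show "norm (one - e *\<^sub>R f) \<le> 1 + e * norm f"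
      using norm_triangle_ineq4[of one "e *\<^sub>R f"] \<open>0 < e\<close> by simp
  qed simp
  finally have "norm f * (1 - norm R * e) \<le> norm R"
    by (simp add: algebra_simps)
  moreover have "1 / 2 \<le> 1 - norm R * e"
    using norm_ge_zero[of R] by (simp add: e_def divide_le_eq add_nonneg_pos)
  then have "norm f * (1 / 2) \<le> norm f * (1 - norm R * e)"
    by (rule mult_left_mono) simp
  ultimately have "norm f \<le> 2 * norm R"
    by simp
  moreover have "1 / e \<le> norm f"
    using neumann_one_ge[OF \<open>growth < t\<close>] norm_bounded[of f all_plus] by (simp add: f t_def)
  ultimately show False
    by (simp add: e_def)
qed

text \<open>The supremum over the spectrum is a maximum, attained at \<open>growth\<close>
  itself.\<close>

lemma lam_eq_growth: "lam A = growth"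
  unfolding lam_def spectral_radius_def
  using growth_in_spectrum spectrum_le_growth growth_pos
  by (intro cSup_eq_maximum) (auto intro!: image_eqI[of _ _ "of_real growth"])

lemma lam_pos: "0 < lam A"
  and lower_le_lam_power: "lower n \<le> lam A ^ n"
  and lam_power_le_upper: "lam A ^ n \<le> upper n"
  by (simp_all add: lam_eq_growth growth_pos lower_le_growth_power growth_power_le_upper)

end

subsection \<open>Cesaro averages\<close>

text \<open>Both sequences are within the gap \<open>\<bar>b n - a n\<bar>\<close> of
  \<open>c\<close>, because \<open>c\<close> lies between them.\<close>

lemma tendsto_squeezed:
  fixes a b :: "nat \<Rightarrow> real"
  assumes a: "\<forall>\<^sub>F n in sequentially. a n \<le> c" and b: "\<forall>\<^sub>F n in sequentially. c \<le> b n"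
    and diff: "(\<lambda>n. \<bar>b n - a n\<bar>) \<longlonglongrightarrow> 0"
  shows "a \<longlonglongrightarrow> c" and "b \<longlonglongrightarrow> c"
proof -
  have "(\<lambda>n. c - \<bar>b n - a n\<bar>) \<longlonglongrightarrow> c - 0"
    by (intro tendsto_intros diff)
  then have lower: "(\<lambda>n. c - \<bar>b n - a n\<bar>) \<longlonglongrightarrow> c"
    by simp
  have "\<forall>\<^sub>F n in sequentially. c - \<bar>b n - a n\<bar> \<le> a n"
    using a b by eventually_elim auto
  then show "a \<longlonglongrightarrow> c"
    using a by (rule tendsto_sandwich[OF _ _ lower tendsto_const])
  have "(\<lambda>n. c + \<bar>b n - a n\<bar>) \<longlonglongrightarrow> c + 0"
    by (intro tendsto_intros diff)
  then have upper: "(\<lambda>n. c + \<bar>b n - a n\<bar>) \<longlonglongrightarrow> c"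
    by simp
  have "\<forall>\<^sub>F n in sequentially. b n \<le> c + \<bar>b n - a n\<bar>"
    using a b by eventually_elim auto
  with b show "b \<longlonglongrightarrow> c"
    by (rule tendsto_sandwich[OF _ _ tendsto_const upper])
qed

lemma ruelle_sum: "ruelle A (\<lambda>x. \<Sum>j\<in>I. f j x) x = (\<Sum>j\<in>I. ruelle A (f j) x)"
  by (simp add: ruelle_eq scaleR_sum_right sum.distrib)

lemma cesaro_add: "cesaro A (\<lambda>x. f x + g x) z n = cesaro A f z n + cesaro A g z n"
  by (simp add: cesaro_def ruelle_pow_add add_divide_distrib sum.distrib distrib_left)

lemma cesaro_scale: "cesaro A (\<lambda>x. c * f x) z n = c * cesaro A f z n"
  using ruelle_pow_scaleR[of _ A c f]
  by (simp add: cesaro_def sum_distrib_left mult.left_commute mult.assoc)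

lemma phi_eq_indicator: "finite B \<Longrightarrow> phi B = indicator {x. \<forall>i\<in>B. x i}"
  by (induction B rule: finite_induct) (auto simp: phi_def spin_def fun_eq_iff indicator_def)

lemma mono_phi: "finite B \<Longrightarrow> mono (phi B)"
  by (auto simp: phi_eq_indicator mono_def le_fun_def indicator_def)

lemma phi_nonneg: "finite B \<Longrightarrow> 0 \<le> phi B x"
  by (simp add: phi_eq_indicator)

lemma continuous_phi: "continuous_on UNIV (phi B)"
proof -
  have "continuous_on UNIV spin"
    by (simp add: continuous_on_open_vimage Topological_Spaces.open_discrete)
  then have "continuous_on UNIV (\<lambda>x::config. spin (x i))" for i
    by (rule continuous_on_compose2) auto
  then show ?thesis
    unfolding phi_def[abs_def] by (intro continuous_intros) auto
qed

context attractive_potential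
begin

lemma cesaro_between:
  assumes "mono f" and "\<And>x. 0 \<le> f x"
  shows "cesaro A f all_minus n \<le> cesaro A f x n"
    and "cesaro A f x n \<le> cesaro A f all_plus n"
  unfolding cesaro_def using lam_pos
  by (auto intro!: mult_left_mono sum_mono divide_right_mono ruelle_pow_between assms)

lemma cesaro_one_bounds:
  assumes "0 < n"
  shows "cesaro A (\<lambda>_. 1) all_minus n \<le> 1" and "1 \<le> cesaro A (\<lambda>_. 1) all_plus n"
proof -
  have "(\<Sum>j<n. lower j / lam A ^ j) \<le> (\<Sum>j<n. 1)"
    by (intro sum_mono) (simp add: lam_pos lower_le_lam_power)
  then show "cesaro A (\<lambda>_. 1) all_minus n \<le> 1"
    using assms by (simp add: cesaro_def)
  have "(\<Sum>j<n. 1) \<le> (\<Sum>j<n. upper j / lam A ^ j)"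
    by (intro sum_mono) (simp add: lam_pos lam_power_le_upper)
  then show "1 \<le> cesaro A (\<lambda>_. 1) all_plus n"
    using assms by (simp add: cesaro_def)
qed

text \<open>The operator shifts the sum by one power: the term \<open>f\<close> drops out and one
  new term enters. In the limit this makes a limit of averages an eigenfunction.\<close>

lemma ruelle_cesaro:
  "ruelle A (\<lambda>y. cesaro A f y n) x
    = lam A / real n * (real (Suc n) * cesaro A f x (Suc n) - f x)"
proof -
  have "ruelle A (\<lambda>y. cesaro A f y n) x
      = 1 / real n * ruelle A (\<lambda>y. \<Sum>j<n. inverse (lam A ^ j) * (ruelle A ^^ j) f y) x"
    unfolding cesaro_def ruelle_mult by (simp add: divide_inverse mult.commute)
  also have "\<dots> = 1 / real n * (\<Sum>j<n. lam A * ((ruelle A ^^ Suc j) f x / lam A ^ Suc j))"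
    unfolding ruelle_sum ruelle_mult using lam_pos
    by (intro arg_cong[where f="\<lambda>s. 1 / real n * s"] sum.cong) (auto simp: field_simps)
  also have "(\<Sum>j<n. lam A * ((ruelle A ^^ Suc j) f x / lam A ^ Suc j))
      = lam A * ((\<Sum>j<Suc n. (ruelle A ^^ j) f x / lam A ^ j) - f x)"
    unfolding sum.lessThan_Suc_shift sum_distrib_left[symmetric] by simp
  finally show ?thesis
    unfolding cesaro_def by simp
qed

end

section \<open>The constant eigenfunction\<close>

locale ergodic_attractive_potential = attractive_potential +
  assumes cesaro_diff: "\<And>B. finite B \<Longrightarrow>
      (\<lambda>n. \<bar>cesaro A (phi B) all_plus n - cesaro A (phi B) all_minus n\<bar>) \<longlonglongrightarrow> 0"
begin

lemma cesaro_one: "cesaro A (\<lambda>_. 1) x \<longlonglongrightarrow> 1"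
proof -
  have diff: "(\<lambda>n. \<bar>cesaro A (\<lambda>_. 1) all_plus n - cesaro A (\<lambda>_. 1) all_minus n\<bar>) \<longlonglongrightarrow> 0"
    \<comment> \<open>The empty product makes \<open>phi {}\<close> the constant 1.\<close>
    using cesaro_diff[of "{}"] by (simp add: phi_def[abs_def])
  \<comment> \<open>The bounds are only eventual: the average at \<open>n = 0\<close> is 0 by
    division by zero, which violates the second one.\<close>
  have "\<forall>\<^sub>F n in sequentially. cesaro A (\<lambda>_. 1) all_minus n \<le> 1"
    and "\<forall>\<^sub>F n in sequentially. 1 \<le> cesaro A (\<lambda>_. 1) all_plus n"
    by (rule eventually_mono[OF eventually_gt_at_top[of 0]], simp add: cesaro_one_bounds)+
  note lims = tendsto_squeezed[OF this diff]
  show ?thesis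
    by (rule tendsto_sandwich[OF _ _ lims])
      (auto intro!: always_eventually cesaro_between monoI)
qed

text \<open>The image of the averages under \<open>ruelle\<close> has two limits: through the finite
  sum over spins it tends to the left side, through \<open>ruelle_cesaro\<close> to the right
  side.\<close>

lemma ruelle_one: "ruelle A (\<lambda>_. 1) x = lam A"
proof -
  let ?c = "cesaro A (\<lambda>_. 1)"
  have eq: "ruelle A (\<lambda>y. ?c y n) x = lam A * (real (Suc n) / real n * ?c x (Suc n) - 1 / real n)" for n
    unfolding ruelle_cesaro by (simp only: right_diff_distrib times_divide_eq_left times_divide_eq_right mult_1_right mult.assoc)
  have "(\<lambda>n. lam A * (real (Suc n) / real n * ?c x (Suc n) - 1 / real n)) \<longlonglongrightarrow> lam A * (1 * 1 - 0)"
    by (intro tendsto_intros LIMSEQ_Suc[OF cesaro_one] LIMSEQ_Suc_n_over_n lim_1_over_n)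
  then have "(\<lambda>n. ruelle A (\<lambda>y. ?c y n) x) \<longlonglongrightarrow> lam A"
    by (simp add: eq)
  moreover have "(\<lambda>n. ruelle A (\<lambda>y. ?c y n) x) \<longlonglongrightarrow> ruelle A (\<lambda>_. 1) x"
    unfolding ruelle_def by (intro tendsto_intros cesaro_one)
  ultimately show ?thesis
    using LIMSEQ_unique by blast
qed

end

subsection \<open>Eigenmeasures\<close>

lemma borel_bool_eq: "sets (borel :: bool measure) = sets (count_space UNIV)"
  by (simp add: sets_borel_eq_count_space)

text \<open>\<open>Measurable.pred\<close> refers to \<open>count_space\<close>, the coordinatewise
  criterion to \<open>borel\<close>; on \<open>bool\<close> the two sigma-algebras agree.\<close>

lemma measurable_into_config:
  assumes "\<And>k. Measurable.pred M (\<lambda>x. f x k)"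
  shows "f \<in> measurable M (borel :: config measure)"
proof (rule measurable_coordinatewise_then_product)
  fix k
  show "(\<lambda>x. f x k) \<in> borel_measurable M"
    using assms[of k] measurable_cong_sets[OF refl borel_bool_eq, of M] by simp
qed

lemma pred_config_coordinate:
  "Measurable.pred (borel :: config measure) (\<lambda>x. x k)"
proof -
  have "(\<lambda>x :: config. x k) \<in> borel_measurable borel"
    by (rule measurable_product_coordinates)
  then show ?thesis
    unfolding measurable_cong_sets[OF refl borel_bool_eq] .
qed

lemma cylinder_in_borel: "C \<in> cylinders \<Longrightarrow> C \<in> sets (borel :: config measure)"
proof -
  note [measurable] = pred_config_coordinate
  have "{x :: config. \<forall>i\<in>B. x i = w i} \<in> sets borel" if [measurable]: "finite B" for B w
  proof -
    have "{x \<in> space borel. \<forall>i\<in>B. (x :: config) i = w i} \<in> sets borel"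
      using that by (intro predE pred_intros_finite(3)) measurable
    then show ?thesis by simp
  qed
  then show "C \<in> cylinders \<Longrightarrow> ?thesis"
    by (auto simp: cylinders_def)
qed

lemma plus_cylinder: "finite B \<Longrightarrow> {x. \<forall>i\<in>B. x i} \<in> cylinders"
  unfolding cylinders_def by (intro CollectI exI[of _ B] exI[of _ all_plus]) simp

lemma sets_borel_config:
  "sets (borel :: config measure) = sigma_sets UNIV {{x. \<forall>i\<in>B. x i} | B. finite B}"
    (is "_ = sigma_sets UNIV ?E")
proof (rule antisym)
  interpret E: sigma_algebra UNIV "sigma_sets UNIV ?E"
    by (rule sigma_algebra_sigma_sets) auto
  have coord: "{x :: config. x i} \<in> sigma_sets UNIV ?E" for i
    by (rule sigma_sets.Basic, intro CollectI exI[of _ "{i}"]) simp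
  have "{x :: config. x i \<in> V} \<in> sigma_sets UNIV ?E" for i V
  proof -
    have "V = {} \<or> V = UNIV \<or> V = {True} \<or> V = {False}"
      using subset_UNIV[of V] unfolding UNIV_bool by blast
    moreover have "{x :: config. x i \<in> {False}} = UNIV - {x. x i}"
      by auto
    ultimately show ?thesis
      using coord[of i] E.compl_sets[OF coord[of i]] by (elim disjE) simp_all
  qed
  then show "sets (borel :: config measure) \<subseteq> sigma_sets UNIV ?E"
    unfolding sets_PiM_equal_borel[symmetric] sets_PiM_single
    by (intro E.sigma_sets_subset') auto
  show "sigma_sets UNIV ?E \<subseteq> sets borel"
    by (intro sets.sigma_sets_subset') (auto intro: cylinder_in_borel plus_cylinder)
qed

text \<open>The plus cylinders generate the Borel sets, are closed under intersection (take the
  union of the index sets) and contain the whole space (\<open>B = {}\<close>), so they determine a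
  finite measure.\<close>

lemma config_measure_eqI:
  fixes \<mu> \<nu> :: "config measure"
  assumes "finite_measure \<mu>" "finite_measure \<nu>" and sets: "sets \<mu> = sets borel" "sets \<nu> = sets borel"
    and eq: "\<And>B. finite B \<Longrightarrow> measure \<mu> {x. \<forall>i\<in>B. x i} = measure \<nu> {x. \<forall>i\<in>B. x i}"
  shows "\<mu> = \<nu>"
proof (rule measure_eqI_generator_eq[where E = "{{x :: config. \<forall>i\<in>B. x i} | B. finite B}"
      and \<Omega> = UNIV and A = "\<lambda>_. UNIV"])
  interpret \<mu>: finite_measure \<mu> by fact
  interpret \<nu>: finite_measure \<nu> by fact
  show "Int_stable {{x :: config. \<forall>i\<in>B. x i} | B. finite B}"
  proof (rule Int_stableI)
    fix C D :: "config set"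
    assume "C \<in> {{x. \<forall>i\<in>B. x i} | B. finite B}" "D \<in> {{x. \<forall>i\<in>B. x i} | B. finite B}"
    then obtain B1 B2 where "finite B1" "finite B2" "C = {x. \<forall>i\<in>B1. x i}" "D = {x. \<forall>i\<in>B2. x i}"
      by blast
    then show "C \<inter> D \<in> {{x. \<forall>i\<in>B. x i} | B. finite B}"
      by (intro CollectI exI[of _ "B1 \<union> B2"]) auto
  qed
  show "emeasure \<mu> X = emeasure \<nu> X" if "X \<in> {{x :: config. \<forall>i\<in>B. x i} | B. finite B}" for X
    using that eq by (auto simp: \<mu>.emeasure_eq_measure \<nu>.emeasure_eq_measure)
  show "range (\<lambda>_. UNIV) \<subseteq> {{x :: config. \<forall>i\<in>B. x i} | B. finite B}"
    by (intro image_subsetI CollectI exI[of _ "{}"]) simp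
qed (simp_all add: sets sets_borel_config finite_measure.emeasure_finite[OF assms(1)])

lemma integrable_continuous_config:
  fixes f :: "config \<Rightarrow> real"
  assumes "finite_measure \<nu>" "sets \<nu> = sets borel" "continuous_on UNIV f"
  shows "integrable \<nu> f"
proof -
  obtain c where "\<And>x. norm (f x) \<le> c"
    using continuous_config_bounded[OF assms(3)] by blast
  moreover have "f \<in> borel_measurable \<nu>"
    using borel_measurable_continuous_onI[OF assms(3)] measurable_cong_sets[OF assms(2) refl] by auto
  ultimately show ?thesis
    by (intro finite_measure.integrable_const_bound[OF assms(1), where B=c]) auto
qed

section \<open>Cesaro limits expressed through an eigenmeasure\<close>

context ergodic_attractive_potential
begin

lemma dual_eigenmeasuresD:
  assumes "\<nu> \<in> dual_eigenmeasures A"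
  shows "finite_measure \<nu>" "prob_space \<nu>" "sets \<nu> = sets borel"
    and "continuous_on UNIV f \<Longrightarrow> integral\<^sup>L \<nu> (ruelle A f) = lam A * integral\<^sup>L \<nu> f"
  using assms unfolding dual_eigenmeasures_def by (auto simp: prob_space_def)

lemma integral_ruelle_pow:
  fixes f :: "config \<Rightarrow> real"
  assumes "\<nu> \<in> dual_eigenmeasures A" "continuous_on UNIV f"
  shows "integral\<^sup>L \<nu> ((ruelle A ^^ n) f) = lam A ^ n * integral\<^sup>L \<nu> f"
  by (induction n)
    (simp_all add: dual_eigenmeasuresD[OF assms(1)] continuous_ruelle_pow[OF assms(2)])

text \<open>Every summand has the integral of \<open>f\<close>, since the powers of
  \<open>lam A\<close> cancel; \<open>n = 0\<close> is excluded because the average is then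
  0.\<close>

lemma integral_cesaro:
  assumes \<nu>: "\<nu> \<in> dual_eigenmeasures A" and f: "continuous_on UNIV f" and "0 < n"
  shows "integral\<^sup>L \<nu> (\<lambda>x. cesaro A f x n) = integral\<^sup>L \<nu> f"
proof -
  have "integrable \<nu> (\<lambda>x. (ruelle A ^^ j) f x / lam A ^ j)" for j
    by (intro integrable_divide integrable_continuous_config dual_eigenmeasuresD[OF \<nu>]
        continuous_ruelle_pow f)
  then show ?thesis
    using lam_pos \<open>0 < n\<close> by (simp add: cesaro_def integral_ruelle_pow[OF \<nu> f])
qed

lemma integrable_cesaro:
  assumes \<nu>: "\<nu> \<in> dual_eigenmeasures A" and f: "continuous_on UNIV f"
  shows "integrable \<nu> (\<lambda>x. cesaro A f x n)"
proof -
  have "integrable \<nu> ((ruelle A ^^ j) f)" for j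
    by (intro integrable_continuous_config dual_eigenmeasuresD[OF \<nu>] continuous_ruelle_pow f)
  then show ?thesis
    unfolding cesaro_def by simp
qed

lemma cesaro_phi:
  assumes \<nu>: "\<nu> \<in> dual_eigenmeasures A" and B: "finite B"
  shows "cesaro A (phi B) x \<longlonglongrightarrow> integral\<^sup>L \<nu> (phi B)"
proof -
  interpret \<nu>: prob_space \<nu>
    by (rule dual_eigenmeasuresD[OF \<nu>])
  note between = cesaro_between[OF mono_phi[OF B] phi_nonneg[OF B]]
  have "cesaro A (phi B) all_minus n \<le> integral\<^sup>L \<nu> (phi B)
      \<and> integral\<^sup>L \<nu> (phi B) \<le> cesaro A (phi B) all_plus n" if "0 < n" for n
    using \<nu>.integral_ge_const[OF integrable_cesaro[OF \<nu> continuous_phi[of B], of n]]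
      \<nu>.integral_le_const[OF integrable_cesaro[OF \<nu> continuous_phi[of B], of n]] that between
    by (simp add: integral_cesaro[OF \<nu> continuous_phi])
  then have "\<forall>\<^sub>F n in sequentially. cesaro A (phi B) all_minus n \<le> integral\<^sup>L \<nu> (phi B)"
    and "\<forall>\<^sub>F n in sequentially. integral\<^sup>L \<nu> (phi B) \<le> cesaro A (phi B) all_plus n"
    by (auto intro: eventually_mono[OF eventually_gt_at_top[of 0]])
  note lims = tendsto_squeezed[OF this cesaro_diff[OF B]]
  show ?thesis
    by (rule tendsto_sandwich[OF _ _ lims]) (auto intro!: always_eventually between)
qed

text \<open>Inclusion-exclusion: a minus constraint at \<open>i\<close> is removed by subtracting
  the cylinder with a plus constraint at \<open>i\<close>. The induction keeps \<open>P\<close>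
  arbitrary because \<open>i\<close> moves into \<open>P\<close>.\<close>

lemma cesaro_signed_cylinder:
  assumes \<nu>: "\<nu> \<in> dual_eigenmeasures A" and "finite N" "finite P"
  defines "C \<equiv> \<lambda>P N. {x :: config. (\<forall>i\<in>P. x i) \<and> (\<forall>i\<in>N. \<not> x i)}"
  shows "cesaro A (indicator (C P N)) x \<longlonglongrightarrow> measure \<nu> (C P N)"
  using assms(2,3)
proof (induction N arbitrary: P rule: finite_induct)
  case empty
  have "C P {} \<in> sets \<nu>"
    unfolding dual_eigenmeasuresD(3)[OF \<nu>]
    using plus_cylinder[OF empty] by (simp add: C_def cylinder_in_borel)
  then have "integral\<^sup>L \<nu> (phi P) = measure \<nu> (C P {})"
    using phi_eq_indicator[OF empty] by (simp add: C_def)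
  then show ?case
    using cesaro_phi[OF \<nu> empty, of x] phi_eq_indicator[OF empty] by (simp add: C_def)
next
  case (insert i N)
  interpret \<nu>: finite_measure \<nu>
    by (rule dual_eigenmeasuresD[OF \<nu>])
  have C_sets: "C P N \<in> sets \<nu>" if "finite P" for P
  \<comment> \<open>For disjoint sets, membership in \<open>P\<close> is a consistent prescription
    on \<open>P \<union> N\<close>; otherwise the constraints clash and the set is empty.\<close>
  proof (cases "P \<inter> N = {}")
    case True
    then show ?thesis
      unfolding dual_eigenmeasuresD(3)[OF \<nu>] using that insert.hyps
      unfolding C_def cylinders_def
      by (intro cylinder_in_borel[unfolded cylinders_def] CollectI exI[of _ "P \<union> N"]
          exI[of _ "\<lambda>i. i \<in> P"]) auto
  next
    case False
    then have "C P N = {}"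
      by (auto simp: C_def)
    then show ?thesis by simp
  qed
  have C_eq: "C P (insert i N) = C P N - C (insert i P) N" and sub: "C (insert i P) N \<subseteq> C P N"
    by (auto simp: C_def)
  have "(indicator (C P (insert i N)) :: config \<Rightarrow> real)
      = (\<lambda>x. indicator (C P N) x + (-1) * indicator (C (insert i P) N) x)"
    using sub by (auto simp: C_eq indicator_def fun_eq_iff)
  then have "cesaro A (indicator (C P (insert i N))) x
      = (\<lambda>n. cesaro A (indicator (C P N)) x n + (-1) * cesaro A (indicator (C (insert i P) N)) x n)"
    by (intro ext) (simp only: cesaro_add cesaro_scale)
  moreover have "(\<lambda>n. cesaro A (indicator (C P N)) x n + (-1) * cesaro A (indicator (C (insert i P) N)) x n)
      \<longlonglongrightarrow> measure \<nu> (C P N) + (-1) * measure \<nu> (C (insert i P) N)"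
    using insert.prems by (intro tendsto_intros insert.IH) auto
  moreover have "measure \<nu> (C P (insert i N)) = measure \<nu> (C P N) + (-1) * measure \<nu> (C (insert i P) N)"
    unfolding C_eq using insert.prems sub by (subst \<nu>.finite_measure_Diff) (auto intro: C_sets)
  ultimately show ?case
    by simp
qed

lemma cesaro_cylinder:
  assumes \<nu>: "\<nu> \<in> dual_eigenmeasures A" and C: "C \<in> cylinders"
  shows "cesaro A (indicator C) x \<longlonglongrightarrow> measure \<nu> C"
proof -
  obtain B w where "finite B" and C: "C = {x. \<forall>i\<in>B. x i = w i}"
    using C unfolding cylinders_def by blast
  have "C = {x. (\<forall>i\<in>{i\<in>B. w i}. x i) \<and> (\<forall>i\<in>{i\<in>B. \<not> w i}. \<not> x i)}"
    by (auto simp: C)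
  with \<open>finite B\<close> show ?thesis
    using cesaro_signed_cylinder[OF \<nu>, of "{i\<in>B. \<not> w i}" "{i\<in>B. w i}" x] by simp
qed

text \<open>The convergence needs no subsequence. This gives the existence of the two Cesaro
  measures and lets \<open>cesaro_measure_unique\<close> compare any two eigenmeasures.\<close>

lemma cesaro_measure_dual_eigenmeasure:
  assumes \<nu>: "\<nu> \<in> dual_eigenmeasures A"
  shows "cesaro_measure A id x \<nu>"
  using dual_eigenmeasuresD[OF \<nu>] cesaro_cylinder[OF \<nu>]
  by (simp add: cesaro_measure_def)

lemma cesaro_measure_unique:
  assumes \<nu>: "\<nu> \<in> dual_eigenmeasures A" and r: "strict_mono r" and \<mu>: "cesaro_measure A r x \<mu>"
  shows "\<mu> = \<nu>"
proof (rule config_measure_eqI)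
  fix B :: "nat set" assume "finite B"
  then have C: "{x :: config. \<forall>i\<in>B. x i} \<in> cylinders" (is "?C \<in> _")
    by (rule plus_cylinder)
  have "(\<lambda>k. cesaro A (indicator ?C) x (r k)) \<longlonglongrightarrow> measure \<nu> ?C"
    using LIMSEQ_subseq_LIMSEQ[OF cesaro_cylinder[OF \<nu> C] r] by (simp add: comp_def)
  moreover have "(\<lambda>k. cesaro A (indicator ?C) x (r k)) \<longlonglongrightarrow> measure \<mu> ?C"
    using \<mu> C unfolding cesaro_measure_def by blast
  ultimately show "measure \<mu> ?C = measure \<nu> ?C"
    by (rule LIMSEQ_unique[rotated])
qed (use \<mu> dual_eigenmeasuresD[OF \<nu>] in \<open>auto simp: cesaro_measure_def\<close>)

lemma dual_eigenmeasure_unique: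
  assumes "\<mu> \<in> dual_eigenmeasures A" "\<nu> \<in> dual_eigenmeasures A"
  shows "\<mu> = \<nu>"
  using cesaro_measure_unique[OF assms(2) strict_mono_id cesaro_measure_dual_eigenmeasure[OF assms(1)]] .

end

subsection \<open>Coupling from the past\<close>

lemma tendsto_config:
  fixes X :: "nat \<Rightarrow> config"
  assumes "\<And>k. \<forall>\<^sub>F n in sequentially. X n k = Y k"
  shows "X \<longlonglongrightarrow> Y"
proof -
  have "(\<lambda>n. X n k) \<longlonglongrightarrow> Y k" for k
    using assms by (rule tendsto_eventually)
  then have "limitin (product_topology (\<lambda>_. euclidean) UNIV) X Y sequentially"
    by (simp add: limitin_componentwise)
  then show ?thesis
    by (simp add: euclidean_product_topology)
qed

text \<open>Each coordinate can switch only once, from \<open>True\<close> to \<open>False\<close>,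
  and is therefore eventually constant.\<close>

lemma decseq_config_tendsto:
  fixes X :: "nat \<Rightarrow> config"
  assumes "\<And>n. X (Suc n) \<le> X n"
  shows "X \<longlonglongrightarrow> (\<lambda>k. \<forall>n. X n k)"
proof (rule tendsto_config)
  fix k
  have antimono: "X n k \<le> X m k" if "m \<le> n" for m n
    using lift_Suc_antimono_le[of X, OF assms that] by (simp add: le_fun_def)
  show "\<forall>\<^sub>F n in sequentially. X n k = (\<forall>n. X n k)"
  proof (cases "\<forall>n. X n k")
    case False
    then obtain m where "\<not> X m k" by blast
    then show ?thesis
      using antimono by (auto intro!: eventually_sequentiallyI[of m])
  qed simp
qed

section \<open>The monotone Markov chain and its stationary law\<close>

context ergodic_attractive_potential
begin

text \<open>By \<open>ruelle_one\<close> the weights divided by \<open>lam A\<close> add up to 1, so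
  this is the probability that the chain prepends +1.\<close>

definition plus_prob :: "config \<Rightarrow> real"
  where "plus_prob x = exp (A (prepend True x)) / lam A"

lemma plus_prob_bounds: "0 \<le> plus_prob x" "plus_prob x \<le> 1"
  and minus_prob: "exp (A (prepend False x)) / lam A = 1 - plus_prob x"
  and plus_prob_mono: "x \<le> y \<Longrightarrow> plus_prob x \<le> plus_prob y"
proof -
  have sum: "exp (A (prepend False x)) + exp (A (prepend True x)) = lam A"
    using ruelle_one[of x] by (simp add: ruelle_eq)
  then have "exp (A (prepend True x)) \<le> lam A"
    by (metis add_increasing exp_ge_zero order_refl)
  then show "0 \<le> plus_prob x" "plus_prob x \<le> 1"
    using lam_pos by (simp_all add: plus_prob_def)
  show "exp (A (prepend False x)) / lam A = 1 - plus_prob x"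
    using sum lam_pos by (simp add: plus_prob_def field_simps)
  show "x \<le> y \<Longrightarrow> plus_prob x \<le> plus_prob y"
    using lam_pos exp_plus_mono by (simp add: plus_prob_def divide_right_mono)
qed

lemma ruelle_eq_plus_prob:
  "ruelle A f x = lam A * ((1 - plus_prob x) * f (prepend False x) + plus_prob x * f (prepend True x))"
  for f :: "config \<Rightarrow> real"
proof -
  have "lam A * (1 - plus_prob x) = exp (A (prepend False x))"
    using lam_pos by (simp add: minus_prob[symmetric])
  moreover have "lam A * plus_prob x = exp (A (prepend True x))"
    using lam_pos by (simp add: plus_prob_def)
  ultimately show ?thesis
    unfolding ruelle_eq distrib_left mult.assoc[symmetric] by simp
qed

lemma plus_prob_measurable [measurable]: "plus_prob \<in> borel_measurable borel"
proof (rule borel_measurable_continuous_onI)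
  have "continuous_on UNIV (\<lambda>x. A (prepend True x))"
    by (rule continuous_on_compose2[OF cont continuous_on_prepend[OF continuous_on_id]]) simp
  then show "continuous_on UNIV plus_prob"
    unfolding plus_prob_def[abs_def] using lam_pos by (intro continuous_intros) auto
qed

text \<open>One move of the chain as a random map driven by a uniform \<open>u\<close>. Using the
  same \<open>u\<close> for all configurations couples the moves monotonically.\<close>

definition step :: "real \<Rightarrow> config \<Rightarrow> config"
  where "step u x = prepend (u < plus_prob x) x"

lemma step_mono: "x \<le> y \<Longrightarrow> step u x \<le> step u y"
  unfolding step_def using plus_prob_mono[of x y] by (intro prepend_mono) auto

lemma step_measurable [measurable]:
  assumes [measurable]: "f \<in> borel_measurable M" "g \<in> measurable M borel"
  shows "(\<lambda>\<omega>. step (f \<omega>) (g \<omega>)) \<in> measurable M borel"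
proof (rule measurable_into_config)
  fix k
  note [measurable] = measurable_compose[OF assms(2) pred_config_coordinate]
  show "Measurable.pred M (\<lambda>\<omega>. step (f \<omega>) (g \<omega>) k)"
    by (cases k) (simp_all add: step_def)
qed

text \<open>
  Coupling from the past: the newest random choice is the innermost one, so that the configurations
  started from \<open>all_plus\<close> decrease and hence converge pointwise.
\<close>

primrec past :: "nat \<Rightarrow> (nat \<Rightarrow> real) \<Rightarrow> config"
  where
    "past 0 \<omega> = all_plus"
  | "past (Suc n) \<omega> = step (\<omega> 0) (past n (\<lambda>k. \<omega> (Suc k)))"

text \<open>Both sides apply the same monotone outer maps; the left one starts them below
  \<open>all_plus\<close>.\<close>

lemma past_decreasing: "past (Suc n) \<omega> \<le> past n \<omega>"
proof (induction n arbitrary: \<omega>)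
  case (Suc n)
  show ?case
    unfolding past.simps(2)[of "Suc n"] past.simps(2)[of n \<omega>] by (rule step_mono[OF Suc.IH])
qed (simp add: le_fun_def)

definition unif :: "real measure"
  where "unif = uniform_measure lborel {0..1}"

lemma sets_unif [measurable_cong]: "sets unif = sets borel"
  by (simp add: unif_def)

lemma prob_space_unif: "prob_space unif"
  unfolding unif_def by (rule prob_space_uniform_measure) auto

lemma measure_unif_lessThan: "0 \<le> p \<Longrightarrow> p \<le> 1 \<Longrightarrow> measure unif {..<p} = p"
proof -
  assume "0 \<le> p" "p \<le> 1"
  then have "{0..1} \<inter> {..<p} = {0..<p}"
    by auto
  with \<open>0 \<le> p\<close> show ?thesis
    by (simp add: unif_def)
qed

lemma integral_step:
  fixes f :: "config \<Rightarrow> real"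
  shows "(\<integral>u. f (step u x) \<partial>unif) = ruelle A f x / lam A"
proof -
  interpret prob_space unif by (rule prob_space_unif)
  let ?m = "f (prepend False x)" and ?p = "f (prepend True x)"
  have "f (step u x) = ?m + indicator {..<plus_prob x} u * (?p - ?m)" for u
    by (simp add: step_def indicator_def)
  then have "(\<integral>u. f (step u x) \<partial>unif)
      = (\<integral>u. ?m + indicator {..<plus_prob x} u * (?p - ?m) \<partial>unif)"
    by simp
  also have "\<dots> = ?m + plus_prob x * (?p - ?m)"
    by (subst Bochner_Integration.integral_add)
      (simp_all add: sets_unif prob_space measure_unif_lessThan plus_prob_bounds emeasure_eq_measure)
  also have "\<dots> = ruelle A f x / lam A"
    using lam_pos by (simp add: ruelle_eq_plus_prob) (simp add: algebra_simps)
  finally show ?thesis .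
qed

abbreviation noise :: "(nat \<Rightarrow> real) measure"
  where "noise \<equiv> Pi\<^sub>M UNIV (\<lambda>_. unif)"

lemma sequence_space_unif: "sequence_space unif"
  unfolding sequence_space_def by (intro product_prob_spaceI prob_space_unif)

lemma prob_space_noise: "prob_space noise"
  by (intro prob_space_PiM prob_space_unif)

lemma past_measurable [measurable]: "past n \<in> measurable noise borel"
proof (induction n)
  case (Suc n)
  have "(\<lambda>\<omega> k. \<omega> (Suc k)) \<in> measurable noise noise"
    by (rule measurable_PiM_single') (auto simp: space_PiM unif_def)
  then have [measurable]: "(\<lambda>\<omega>. past n (\<lambda>k. \<omega> (Suc k))) \<in> measurable noise borel"
    by (rule measurable_compose) (rule Suc.IH)
  show ?case
    unfolding past.simps by measurable
qed simp

text \<open>The outermost step is integrated out first, which replaces \<open>f\<close> by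
  \<open>ruelle A f / lam A\<close>; hence the induction over arbitrary \<open>f\<close>.\<close>

lemma integral_past:
  fixes f :: "config \<Rightarrow> real"
  assumes "continuous_on UNIV f"
  shows "(\<integral>\<omega>. f (past n \<omega>) \<partial>noise) = (ruelle A ^^ n) f all_plus / lam A ^ n"
  using assms
proof (induction n arbitrary: f)
  case 0
  then show ?case
    by (simp add: prob_space.prob_space[OF prob_space_noise])
next
  case (Suc n)
  interpret U: prob_space unif by (rule prob_space_unif)
  interpret S: prob_space noise by (rule prob_space_noise)
  interpret pair_prob_space unif noise ..
  have [measurable]: "f \<in> borel_measurable borel"
    by (rule borel_measurable_continuous_onI) fact
  obtain c where c: "\<And>x. norm (f x) \<le> c"
    using continuous_config_bounded[OF Suc.prems] by blast
  have [measurable]: "(\<lambda>(u, \<omega>). case_nat u \<omega>) \<in> measurable (unif \<Otimes>\<^sub>M noise) noise"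
    by measurable
  \<comment> \<open>The noise is split into its first entry and an independent copy of the whole
    sequence.\<close>
  have "(\<integral>\<omega>. f (past (Suc n) \<omega>) \<partial>noise)
      = (\<integral>\<omega>. f (past (Suc n) \<omega>) \<partial>distr (unif \<Otimes>\<^sub>M noise) noise (\<lambda>(u, \<omega>). case_nat u \<omega>))"
    by (simp only: sequence_space.PiM_iter[OF sequence_space_unif])
  also have "\<dots> = (\<integral>z. f (past (Suc n) ((\<lambda>(u, \<omega>). case_nat u \<omega>) z)) \<partial>(unif \<Otimes>\<^sub>M noise))"
    by (intro integral_distr) measurable
  also have "\<dots> = (\<integral>(u, \<omega>). f (step u (past n \<omega>)) \<partial>(unif \<Otimes>\<^sub>M noise))"
    by (simp add: case_prod_unfold)
  also have "\<dots> = (\<integral>\<omega>. (\<integral>u. f (step u (past n \<omega>)) \<partial>unif) \<partial>noise)"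
    by (intro integral_snd[symmetric] P.integrable_const_bound[where B=c]) (auto intro!: AE_I2 simp: c[simplified] split: prod.split)
  also have "\<dots> = (\<integral>\<omega>. ruelle A f (past n \<omega>) \<partial>noise) / lam A"
    by (simp add: integral_step)
  also have "(\<integral>\<omega>. ruelle A f (past n \<omega>) \<partial>noise) = (ruelle A ^^ n) (ruelle A f) all_plus / lam A ^ n"
    by (intro Suc.IH continuous_ruelle Suc.prems)
  finally show ?case
    by (simp add: funpow_swap1 mult.commute)
qed

text \<open>The law of the pointwise limit of \<open>past\<close> works: dominated convergence
  identifies its integrals as limits of normalised iterates at \<open>all_plus\<close>.\<close>

lemma dual_eigenmeasure_exists: "\<exists>\<nu>. \<nu> \<in> dual_eigenmeasures A"
proof -
  interpret S: prob_space noise by (rule prob_space_noise)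
  define limit where "limit \<omega> k \<longleftrightarrow> (\<forall>n. past n \<omega> k)" for \<omega> k
  have [measurable]: "limit \<in> measurable noise borel"
  proof (rule measurable_into_config)
    fix k
    note [measurable] = measurable_compose[OF past_measurable pred_config_coordinate]
    show "Measurable.pred noise (\<lambda>\<omega>. limit \<omega> k)"
      unfolding limit_def by measurable
  qed
  have past_tendsto: "(\<lambda>n. past n \<omega>) \<longlonglongrightarrow> limit \<omega>" for \<omega>
    unfolding limit_def[abs_def] by (intro decseq_config_tendsto past_decreasing)
  define \<nu> where "\<nu> = distr noise borel limit"
  have lim: "(\<lambda>n. (ruelle A ^^ n) f all_plus / lam A ^ n) \<longlonglongrightarrow> integral\<^sup>L \<nu> f"
    if f: "continuous_on UNIV f" for f :: "config \<Rightarrow> real"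
  proof -
    have [measurable]: "f \<in> borel_measurable borel"
      by (rule borel_measurable_continuous_onI) fact
    obtain c where c: "\<And>x. norm (f x) \<le> c"
      using continuous_config_bounded[OF f] by blast
    have "(\<lambda>n. f (past n \<omega>)) \<longlonglongrightarrow> f (limit \<omega>)" for \<omega>
      using f past_tendsto by (rule continuous_on_tendsto_compose) auto
    then have "(\<lambda>n. \<integral>\<omega>. f (past n \<omega>) \<partial>noise) \<longlonglongrightarrow> (\<integral>\<omega>. f (limit \<omega>) \<partial>noise)"
      using c by (intro integral_dominated_convergence[where w="\<lambda>_. c"]) auto
    then show ?thesis
      by (simp add: integral_past[OF f] \<nu>_def integral_distr)
  qed
  have "integral\<^sup>L \<nu> (ruelle A f) = lam A * integral\<^sup>L \<nu> f"
    if f: "continuous_on UNIV f" for f :: "config \<Rightarrow> real"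
  proof -
    \<comment> \<open>The same sequence, read with its index shifted, is the one that converges to
      the integral of \<open>ruelle A f\<close>.\<close>
    have "(\<lambda>n. lam A * ((ruelle A ^^ Suc n) f all_plus / lam A ^ Suc n)) \<longlonglongrightarrow> lam A * integral\<^sup>L \<nu> f"
      by (intro tendsto_intros LIMSEQ_Suc[OF lim[OF f]])
    moreover have "lam A * ((ruelle A ^^ Suc n) f all_plus / lam A ^ Suc n)
        = (ruelle A ^^ n) (ruelle A f) all_plus / lam A ^ n" for n
      using lam_pos by (simp add: funpow_swap1)
    ultimately show ?thesis
      using lim[OF continuous_ruelle[OF f]] LIMSEQ_unique by simp
  qed
  moreover have "prob_space \<nu>" "sets \<nu> = sets borel"
    unfolding \<nu>_def by (auto intro: S.prob_space_distr)
  ultimately show ?thesis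
    unfolding dual_eigenmeasures_def by blast
qed

lemma dual_eigenmeasures_singleton: "\<exists>\<nu>. dual_eigenmeasures A = {\<nu>}"
  using dual_eigenmeasure_exists dual_eigenmeasure_unique by blast

end

theorem proposition7:
  fixes A :: "config \<Rightarrow> real"
  assumes cont: "continuous_on UNIV A"
    and class_F: "A \<in> class_F"
    and inf_pos: "\<exists>x. 0 < (INF n\<in>{1..}. (ruelle A ^^ n) (\<lambda>_. 1 :: real) x / lam A ^ n)"
    and cesaro_diff: "\<And>B. finite B \<Longrightarrow>
      (\<lambda>n. \<bar>cesaro A (phi B) all_plus n - cesaro A (phi B) all_minus n\<bar>) \<longlonglongrightarrow> 0"
  shows "(\<exists>h :: config \<Rightarrow> real. continuous_on UNIV h \<and> (\<forall>x. 0 < h x) \<and>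
            (\<forall>x. ruelle A h x = lam A * h x)) \<and>
         (\<exists>r \<mu>\<^sub>p \<mu>\<^sub>m. strict_mono r \<and>
            cesaro_measure A r all_plus \<mu>\<^sub>p \<and> cesaro_measure A r all_minus \<mu>\<^sub>m) \<and>
         (\<forall>r \<mu>\<^sub>p \<mu>\<^sub>m. strict_mono r \<and>
            cesaro_measure A r all_plus \<mu>\<^sub>p \<and> cesaro_measure A r all_minus \<mu>\<^sub>m \<longrightarrow> \<mu>\<^sub>p = \<mu>\<^sub>m) \<and>
         (\<exists>\<nu>. dual_eigenmeasures A = {\<nu>})"
proof -
  interpret ergodic_attractive_potential A
    by unfold_locales (fact cont class_F cesaro_diff)+
  obtain \<nu> where \<nu>: "\<nu> \<in> dual_eigenmeasures A"
    using dual_eigenmeasure_exists by blast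
  have "\<exists>h :: config \<Rightarrow> real. continuous_on UNIV h \<and> (\<forall>x. 0 < h x) \<and>
      (\<forall>x. ruelle A h x = lam A * h x)"
    by (rule exI[of _ "\<lambda>_. 1"]) (simp add: ruelle_one)
  moreover have "\<exists>r \<mu>\<^sub>p \<mu>\<^sub>m. strict_mono r \<and>
      cesaro_measure A r all_plus \<mu>\<^sub>p \<and> cesaro_measure A r all_minus \<mu>\<^sub>m"
    using strict_mono_id cesaro_measure_dual_eigenmeasure[OF \<nu>] by blast
  moreover have "\<mu>\<^sub>p = \<mu>\<^sub>m" if "strict_mono r" "cesaro_measure A r all_plus \<mu>\<^sub>p"
    "cesaro_measure A r all_minus \<mu>\<^sub>m" for r \<mu>\<^sub>p \<mu>\<^sub>m
    using that cesaro_measure_unique[OF \<nu>] by metis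
  ultimately show ?thesis
    using dual_eigenmeasures_singleton by blast
qed

end
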